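(* Let $\Omega\subset\mathbb{R}^n$ be a convex domain, let $a^{ij}:\mathbb{R}^n\to\mathbb{R}$ ($i,j=1,\dots,n$) be measurable and let $b:\Omega\times\mathbb{R}\times\mathbb{R}^n\to\mathbb{R}$ be differentiable in its second variable. Assume that the matrix $[a^{ij}(\xi)]_{i,j}$ is symmetric and positive definite for all $\xi\in\mathbb{R}^n$. Let $u\in C^2(\Omega)\cap C(\overline\Omega)$ be a solution of $$\sum_{i,j=1}^n a^{ij}(Du)\,\partial^2_{ij}u-b(x,u,Du)=0\quad\text{in }\Omega,$$ and set $M:=\|u\|_{C^2(\Omega)}$, $m:=\|u\|_{L^\infty(\Omega)}$. Assume that for some $\delta\ge 0$ and $\beta>0$ $$\partial_s b(x,s,z)\ge\beta\quad\text{for all }(x,s,z)\in\Omega\times[-m,m]\times\overline B_M,$$ $$\mathcal C_{-b(\cdot,u(\cdot),z)}(x_1,x_3,\lambda)\le\delta\quad\text{for all }(x_1,x_3,\lambda)\in\Omega\times\Omega\times[0,1]\text{ and all }z\in\overline B_M.$$ If $\mathcal C_u$ achieves a positive interior maximum in $\Omega\times\Omega\times[0,1]$, then there exist a convex function $v:\Omega\to\mathbb{R}$ and a constant $k_n>0$, depending only on $n$, such that $$\|u-v\|_{L^\infty(\Omega)}\le\frac{k_n}{\beta}\,\delta.$$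
   Context: A domain is a connected open set. For $u:\overline\Omega\to\mathbb{R}$, $y_1,y_3\in\overline\Omega$, $\lambda\in[0,1]$, the convexity function is $$\mathcal C_u(y_1,y_3,\lambda):=u(\lambda y_1+(1-\lambda)y_3)-\lambda u(y_1)-(1-\lambda)u(y_3).$$ "$\mathcal C_u$ achieves a positive interior maximum in $\Omega\times\Omega\times[0,1]$" means that $\mathcal C_u$ attains its maximum at some $(x_1,x_3,\lambda)$ with $x_1,x_3\in\Omega$ (hence also $\lambda x_1+(1-\lambda)x_3\in\Omega$), $\lambda\in[0,1]$, and that the maximum value is positive. For fixed $z$, the joint convexity function of $-b(\cdot,\cdot,z)$ along $u$ is $$\mathcal C_{-b(\cdot,u(\cdot),z)}(x_1,x_3,\lambda):=-b\big(x_2,\lambda u(x_1)+(1-\lambda)u(x_3),z\big)+\lambda b(x_1,u(x_1),z)+(1-\lambda)b(x_3,u(x_3),z),\qquad x_2:=\lambda x_1+(1-\lambda)x_3.$$ $\overline B_M$ is the closed ball of radius $M$ centered at $0$ in $\mathbb{R}^n$ (read as $\mathbb{R}^n$ if $M=\infty$; likewise $[-m,m]$ is read as $\mathbb{R}$ if $m=\infty$). *)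

theory Defs
  imports "HOL-Analysis.Analysis" "HOL-Probability.Essential_Supremum"
begin

definition partial_derivative :: "'n::finite \<Rightarrow> (real^'n \<Rightarrow> real) \<Rightarrow> real^'n \<Rightarrow> real" where
  "partial_derivative i f x = frechet_derivative f (at x) (axis i 1)"

definition grad :: "(real^'n::finite \<Rightarrow> real) \<Rightarrow> real^'n \<Rightarrow> real^'n" where
  "grad f x = (\<chi> i. partial_derivative i f x)"

definition hessian :: "(real^'n::finite \<Rightarrow> real) \<Rightarrow> real^'n \<Rightarrow> real^'n^'n" where
  "hessian f x = (\<chi> i j. partial_derivative i (partial_derivative j f) x)"

(* Meant for open S. Differentiability at each order makes f and its first partial
   derivatives continuous, so continuity is only required of the second order ones. *)
definition C2_on :: "(real^'n::finite) set \<Rightarrow> (real^'n \<Rightarrow> real) \<Rightarrow> bool" where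
  "C2_on S f \<longleftrightarrow>
     (\<forall>x\<in>S. f differentiable (at x)) \<and>
     (\<forall>i. \<forall>x\<in>S. partial_derivative i f differentiable (at x)) \<and>
     (\<forall>i j. continuous_on S (partial_derivative i (partial_derivative j f)))"

(* Norms take values in [0, \<infinity>]; nothing forces u or its derivatives to be bounded.
   The norms of grad f x and hessian f x are Euclidean (Frobenius for the matrix). *)
definition C2_norm :: "(real^'n::finite) set \<Rightarrow> (real^'n \<Rightarrow> real) \<Rightarrow> ennreal" where
  "C2_norm S f =
     (SUP x\<in>S. ennreal \<bar>f x\<bar>) + (SUP x\<in>S. ennreal (norm (grad f x))) +
     (SUP x\<in>S. ennreal (norm (hessian f x)))"

definition Linfty_norm :: "(real^'n::finite) set \<Rightarrow> (real^'n \<Rightarrow> real) \<Rightarrow> ennreal" where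
  "Linfty_norm S f = esssup (lebesgue_on S) (\<lambda>x. ennreal \<bar>f x\<bar>)"

(* Closed ball about 0 with possibly infinite radius: everything if r = \<infinity>.
   On the reals this is the interval [-r, r]. *)
definition ext_cball :: "ennreal \<Rightarrow> 'a::real_normed_vector set" where
  "ext_cball r = {z. ennreal (norm z) \<le> r}"

definition positive_definite :: "real^'n::finite^'n \<Rightarrow> bool" where
  "positive_definite A \<longleftrightarrow> (\<forall>v. v \<noteq> 0 \<longrightarrow> v \<bullet> (A *v v) > 0)"

definition convexity_fun ::
    "(real^'n::finite \<Rightarrow> real) \<Rightarrow> real^'n \<Rightarrow> real^'n \<Rightarrow> real \<Rightarrow> real" where
  "convexity_fun u y1 y3 l =
     u (l *\<^sub>R y1 + (1 - l) *\<^sub>R y3) - l * u y1 - (1 - l) * u y3"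

(* The joint convexity function of -b(., ., z) along u; the argument is b itself. *)
definition joint_convexity_fun_neg ::
    "(real^'n::finite \<Rightarrow> real \<Rightarrow> real^'n \<Rightarrow> real) \<Rightarrow> (real^'n \<Rightarrow> real) \<Rightarrow> real^'n \<Rightarrow>
     real^'n \<Rightarrow> real^'n \<Rightarrow> real \<Rightarrow> real" where
  "joint_convexity_fun_neg b u z x1 x3 l =
     - b (l *\<^sub>R x1 + (1 - l) *\<^sub>R x3) (l * u x1 + (1 - l) * u x3) z
     + l * b x1 (u x1) z + (1 - l) * b x3 (u x3) z"

(* The convexity function lives on closure S; its maximum over that whole domain
   is attained with both end points in S, and is positive. *)
definition positive_interior_max :: "(real^'n::finite) set \<Rightarrow> (real^'n \<Rightarrow> real) \<Rightarrow> bool" where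
  "positive_interior_max S u \<longleftrightarrow>
     (\<exists>x1\<in>S. \<exists>x3\<in>S. \<exists>l\<in>{0..1}.
        convexity_fun u x1 x3 l > 0 \<and>
        (\<forall>y1\<in>closure S. \<forall>y3\<in>closure S. \<forall>t\<in>{0..1}.
           convexity_fun u y1 y3 t \<le> convexity_fun u x1 x3 l))"

end

theory Submission
  imports Defs
begin

text \<open>
  Where the convexity function of \<open>u\<close> is maximal, at \<open>(x\<^sub>1, x\<^sub>3, \<lambda>)\<close> with
  \<open>x\<^sub>2 = \<lambda> x\<^sub>1 + (1 - \<lambda>) x\<^sub>3\<close>, moving one end point alone shows that the gradients of \<open>u\<close> at
  the three points agree, with common value \<open>\<zeta>\<close>, and translating all three points together shows
  that \<open>\<lambda> D\<^sup>2u(x\<^sub>1) + (1 - \<lambda>) D\<^sup>2u(x\<^sub>3) - D\<^sup>2u(x\<^sub>2)\<close> is positive semidefinite. As the gradients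
  agree, the equation has the same coefficient matrix at the three points, and its contraction
  with a positive semidefinite matrix is nonnegative (\<open>psd_contraction_nonneg\<close>). Hence
  \<open>b(x\<^sub>2, u(x\<^sub>2), \<zeta>) \<le> \<lambda> b(x\<^sub>1, u(x\<^sub>1), \<zeta>) + (1 - \<lambda>) b(x\<^sub>3, u(x\<^sub>3), \<zeta>)\<close>. The joint convexity
  hypothesis bounds the right-hand side by \<open>\<delta> + b(x\<^sub>2, \<lambda> u(x\<^sub>1) + (1 - \<lambda>) u(x\<^sub>3), \<zeta>)\<close>. The two
  values of the second argument differ by the maximum of the convexity function, so the
  monotonicity of \<open>b\<close> bounds this maximum by \<open>\<delta> / \<beta>\<close> (\<open>positive_max_le\<close>).

  Thus \<open>u\<close> satisfies Jensen's inequality for two points up to the error \<open>\<delta> / \<beta>\<close>. A theorem of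
  Hyers and Ulam (\<open>approx_convex_imp_near_convex\<close>) then provides \<open>v\<close>: the lower boundary of the
  convex hull of the graph of \<open>u\<close> lies below \<open>u\<close>, and, since Caratheodory's theorem limits
  the number of points in a convex combination, it lies below by at most a dimensional multiple of
  the error.
\<close>

section \<open>Stability of convexity\<close>

text \<open>Splitting off one point of a convex combination costs one application of the two-point
  inequality. The errors of the remaining points are multiplied by a weight at most \<open>1\<close>,
  so they do not accumulate faster than linearly.\<close>

lemma approx_jensen:
  fixes f :: "'a::real_vector \<Rightarrow> real" and x :: "'i \<Rightarrow> 'a" and e :: real
  assumes "convex S" and "e \<ge> 0"
    and approx: "\<And>x y t. x \<in> S \<Longrightarrow> y \<in> S \<Longrightarrow> 0 \<le> t \<Longrightarrow> t \<le> 1 \<Longrightarrow>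
      f (t *\<^sub>R x + (1 - t) *\<^sub>R y) \<le> t * f x + (1 - t) * f y + e"
    and "finite I" "\<And>i. i \<in> I \<Longrightarrow> c i \<ge> 0" "sum c I = 1" "\<And>i. i \<in> I \<Longrightarrow> x i \<in> S"
  shows "f (\<Sum>i\<in>I. c i *\<^sub>R x i) \<le> (\<Sum>i\<in>I. c i * f (x i)) + card I * e"
  using assms(4-)
proof (induction I arbitrary: c rule: finite_induct)
  case empty
  then show ?case by simp
next
  case (insert i I)
  have ci: "c i \<ge> 0" and sumI: "sum c I = 1 - c i" and cI: "\<And>j. j \<in> I \<Longrightarrow> c j \<ge> 0"
    using insert.hyps insert.prems by auto
  have "c i \<le> 1" using sumI sum_nonneg[of I c] cI by fastforce
  show ?case
  proof (cases "c i = 1")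
    case True
    then have "\<And>j. j \<in> I \<Longrightarrow> c j = 0"
      using sumI cI insert.hyps(1) by (simp add: sum_nonneg_eq_0_iff)
    then show ?thesis using insert.hyps True \<open>e \<ge> 0\<close> by simp
  next
    case False
    define d where "d j = c j / (1 - c i)" for j
    define y where "y = (\<Sum>j\<in>I. d j *\<^sub>R x j)"
    have pos: "1 - c i > 0" using False \<open>c i \<le> 1\<close> by simp
    have d0: "\<And>j. j \<in> I \<Longrightarrow> d j \<ge> 0" and d1: "sum d I = 1"
      using cI pos sumI by (simp_all add: d_def sum_divide_distrib[symmetric])
    have yS: "y \<in> S"
      unfolding y_def using insert.hyps insert.prems d0 d1 by (intro convex_sum[OF _ \<open>convex S\<close>]) auto
    have cd: "(1 - c i) * d j = c j" for j using pos by (simp add: d_def)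
    have "f (\<Sum>j\<in>insert i I. c j *\<^sub>R x j) = f (c i *\<^sub>R x i + (1 - c i) *\<^sub>R y)"
    proof -
      have "(\<Sum>j\<in>I. c j *\<^sub>R x j) = (1 - c i) *\<^sub>R y"
        by (simp add: y_def scaleR_sum_right cd)
      then show ?thesis using insert.hyps by simp
    qed
    also have "\<dots> \<le> c i * f (x i) + (1 - c i) * f y + e"
      using approx[of "x i" y "c i"] yS ci \<open>c i \<le> 1\<close> insert.prems by simp
    also have "(1 - c i) * f y \<le> (1 - c i) * ((\<Sum>j\<in>I. d j * f (x j)) + card I * e)"
      using insert.IH[of d] d0 d1 insert.prems pos unfolding y_def by (intro mult_left_mono) auto
    also have "\<dots> = (\<Sum>j\<in>I. c j * f (x j)) + (1 - c i) * (card I * e)"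
      by (simp add: distrib_left sum_distrib_left mult.assoc[symmetric] cd)
    also have "(1 - c i) * (card I * e) \<le> card I * e"
      using ci \<open>e \<ge> 0\<close> by (intro mult_left_le_one_le) (use pos in auto)
    finally show ?thesis using insert.hyps by (simp add: algebra_simps)
  qed
qed

text \<open>The theorem of Hyers and Ulam. The function \<open>g\<close> is the convex envelope of \<open>f\<close>, whose values
  are the infima of the vertical slices of the convex hull of the graph of \<open>f\<close>. The constant
  \<open>DIM('a) + 2\<close> is the number of points that Caratheodory's theorem yields in \<open>'a \<times> real\<close>.\<close>

theorem approx_convex_imp_near_convex:
  fixes f :: "'a::euclidean_space \<Rightarrow> real" and e :: real
  assumes "convex S" and "e \<ge> 0"
    and approx: "\<And>x y t. x \<in> S \<Longrightarrow> y \<in> S \<Longrightarrow> 0 \<le> t \<Longrightarrow> t \<le> 1 \<Longrightarrow>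
      f (t *\<^sub>R x + (1 - t) *\<^sub>R y) \<le> t * f x + (1 - t) * f y + e"
  obtains g where "convex_on S g" "\<And>x. x \<in> S \<Longrightarrow> \<bar>f x - g x\<bar> \<le> (DIM('a) + 2) * e"
proof -
  define C where "C = convex hull ((\<lambda>x. (x, f x)) ` S)"
  define g where "g x = Inf {t. (x, t) \<in> C}" for x
  have below: "f x - (DIM('a) + 2) * e \<le> t" if xt: "(x, t) \<in> C" for x t
  proof -
    obtain T where T: "finite T" "T \<subseteq> (\<lambda>x. (x, f x)) ` S" "card T \<le> DIM('a) + 2"
      "(x, t) \<in> convex hull T"
      using xt unfolding C_def caratheodory[of "(\<lambda>x. (x, f x)) ` S"] by auto
    obtain c where c: "\<And>p. p \<in> T \<Longrightarrow> c p \<ge> 0" "sum c T = 1" "(\<Sum>p\<in>T. c p *\<^sub>R p) = (x, t)"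
      using T(4) unfolding convex_hull_finite[OF T(1)] by auto
    have "(\<Sum>p\<in>T. c p *\<^sub>R fst p) = x" "(\<Sum>p\<in>T. c p * snd p) = t"
      using arg_cong[OF c(3), of fst] arg_cong[OF c(3), of snd] by (simp_all add: fst_sum snd_sum)
    moreover have "(\<Sum>p\<in>T. c p * f (fst p)) = (\<Sum>p\<in>T. c p * snd p)"
      using T(2) by (intro sum.cong) auto
    moreover have "\<And>p. p \<in> T \<Longrightarrow> fst p \<in> S" using T(2) by auto
    ultimately have "f x \<le> t + card T * e"
      using approx_jensen[OF assms T(1), of c fst] c by simp
    also have "\<dots> \<le> t + (DIM('a) + 2) * e"
      using T(3) \<open>e \<ge> 0\<close> by (intro add_left_mono mult_right_mono) linarith+
    finally show ?thesis by simp
  qed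
  have mem: "(x, f x) \<in> C" if "x \<in> S" for x
    unfolding C_def using that by (intro hull_inc) auto
  have bdd: "bdd_below {t. (x, t) \<in> C}" for x
    using below by (intro bdd_belowI) blast
  have upper: "g x \<le> f x" if "x \<in> S" for x
    unfolding g_def using mem[OF that] bdd by (intro cInf_lower) auto
  have lower: "f x - (DIM('a) + 2) * e \<le> g x" if "x \<in> S" for x
    unfolding g_def using mem[OF that] below by (intro cInf_greatest) auto
  have "convex_on S g"
  proof (rule convex_onI)
    fix r :: real and x y
    assume r: "0 < r" "r < 1" and xy: "x \<in> S" "y \<in> S"
    show "g ((1 - r) *\<^sub>R x + r *\<^sub>R y) \<le> (1 - r) * g x + r * g y"
    proof (rule field_le_epsilon)
      fix h :: real assume "h > 0"
      have "\<exists>t. (z, t) \<in> C \<and> t < g z + h" if "z \<in> S" for z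
        using cInf_lessD[of "{t. (z, t) \<in> C}" "g z + h"] mem[OF that] \<open>h > 0\<close>
        unfolding g_def by auto
      then obtain s t where st: "(x, s) \<in> C" "s < g x + h" "(y, t) \<in> C" "t < g y + h"
        using xy by blast
      have "(1 - r) *\<^sub>R (x, s) + r *\<^sub>R (y, t) \<in> C"
        using st r convex_convex_hull unfolding C_def by (intro convexD) auto
      then have "g ((1 - r) *\<^sub>R x + r *\<^sub>R y) \<le> (1 - r) * s + r * t"
        unfolding g_def using bdd by (intro cInf_lower) auto
      also have "\<dots> \<le> (1 - r) * (g x + h) + r * (g y + h)"
        using st r by (intro add_mono mult_left_mono) auto
      finally show "g ((1 - r) *\<^sub>R x + r *\<^sub>R y) \<le> (1 - r) * g x + r * g y + h"
        by (simp add: algebra_simps)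
    qed
  qed fact
  moreover have "\<bar>f x - g x\<bar> \<le> (DIM('a) + 2) * e" if "x \<in> S" for x
    using upper[OF that] lower[OF that] by simp
  ultimately show ?thesis by (rule that)
qed

section \<open>Contraction of positive semidefinite matrices\<close>

text \<open>If the diagonal entry \<open>A $ i $ i\<close> is positive, completing the square in the \<open>i\<close>-th
  coordinate (one step of the Cholesky decomposition) subtracts from \<open>A\<close> a positive multiple of
  \<open>w w\<^sup>T\<close>, where \<open>w\<close> is its \<open>i\<close>-th column. The difference is again positive semidefinite, its
  \<open>i\<close>-th row and column vanish, and the contraction of \<open>H\<close> with \<open>w w\<^sup>T\<close> is the value at \<open>w\<close> of
  the quadratic form of \<open>H\<close>. If the entry is zero, semidefiniteness forces the \<open>i\<close>-th row to
  vanish already. The induction is over the set of rows of \<open>A\<close> not yet known to vanish.\<close>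

lemma psd_contraction_nonneg:
  fixes A H :: "real^'n::finite^'n"
  assumes "transpose A = A" "\<And>v. v \<bullet> (A *v v) \<ge> 0" "\<And>v. v \<bullet> (H *v v) \<ge> 0"
  shows "(\<Sum>i\<in>UNIV. \<Sum>j\<in>UNIV. A $ i $ j * H $ i $ j) \<ge> 0"
proof -
  have main: "(\<Sum>i\<in>UNIV. \<Sum>j\<in>UNIV. A $ i $ j * H $ i $ j) \<ge> 0"
    if "finite S" and sym: "\<And>i j. A $ i $ j = A $ j $ i" and psd: "\<And>v. v \<bullet> (A *v v) \<ge> 0"
      and supp: "\<And>i j. i \<notin> S \<Longrightarrow> A $ i $ j = 0" for S and A :: "real^'n^'n"
    using that
  proof (induction S arbitrary: A rule: finite_induct)
    case empty
    then show ?case by simp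
  next
    case (insert i S A)
    define w where "w = column i A"
    have wk: "w $ k = A $ k $ i" for k by (simp add: w_def column_def)
    have row: "(A *v v) $ i = w \<bullet> v" for v
      using insert.prems(1) by (simp add: matrix_vector_mult_def inner_vec_def wk)
    have col: "A *v axis i 1 = w" by (simp add: w_def matrix_vector_mult_basis)
    have quad: "(v + t *\<^sub>R axis i 1) \<bullet> (A *v (v + t *\<^sub>R axis i 1))
        = v \<bullet> (A *v v) + 2 * t * (w \<bullet> v) + t\<^sup>2 * A $ i $ i" for v t
    proof -
      have "axis i 1 \<bullet> (A *v v) = w \<bullet> v" using row by (simp add: inner_axis')
      moreover have "axis i 1 \<bullet> w = A $ i $ i" by (simp add: inner_axis' wk)
      ultimately show ?thesis
        by (simp add: matrix_vector_right_distrib matrix_vector_mult_scaleR col inner_simps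
          inner_commute[of v w] power2_eq_square algebra_simps)
    qed
    have "A $ i $ i \<ge> 0"
      using insert.prems(2)[of "axis i 1"] col by (simp add: inner_axis' wk)
    show ?case
    proof (cases "A $ i $ i = 0")
      case True
      have "A $ i $ j = 0" for j
      proof (rule ccontr)
        assume "A $ i $ j \<noteq> 0"
        \<comment> \<open>Along the line through \<open>axis j 1\<close> in direction \<open>axis i 1\<close> the form is affine and
          nonconstant; this \<open>t\<close> makes its value \<open>-1\<close>.\<close>
        define t where "t = - (A $ j $ j + 1) / (2 * A $ i $ j)"
        have "w \<bullet> axis j 1 = A $ i $ j" using insert.prems(1) by (simp add: inner_axis wk)
        moreover have "axis j 1 \<bullet> (A *v axis j 1) = A $ j $ j"
          by (simp add: matrix_vector_mult_basis column_def inner_axis')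
        ultimately have "0 \<le> A $ j $ j + 2 * t * A $ i $ j"
          using insert.prems(2)[of "axis j 1 + t *\<^sub>R axis i 1"] quad[of "axis j 1" t] True by simp
        then show False using \<open>A $ i $ j \<noteq> 0\<close> by (simp add: t_def field_simps)
      qed
      then have "A $ k $ l = 0" if "k \<notin> S" for k l
        using that insert.prems(3) by (cases "k = i") simp_all
      then show ?thesis by (intro insert.IH insert.prems(1,2))
    next
      case False
      then have pos: "A $ i $ i > 0" using \<open>A $ i $ i \<ge> 0\<close> by simp
      define B where "B = (\<chi> k l. A $ k $ l - w $ k * w $ l / A $ i $ i)"
      have Bv: "B *v v = A *v v - (w \<bullet> v / A $ i $ i) *\<^sub>R w" for v
        by (simp add: B_def matrix_vector_mult_def vec_eq_iff inner_vec_def sum_subtractf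
          left_diff_distrib right_diff_distrib sum_divide_distrib sum_distrib_left
          sum_distrib_right mult_ac)
      have "v \<bullet> (B *v v) \<ge> 0" for v
        using insert.prems(2)[of "v + (- (w \<bullet> v) / A $ i $ i) *\<^sub>R axis i 1"] pos unfolding quad Bv
        by (simp add: inner_simps inner_commute[of v w] power2_eq_square field_simps)
      moreover have "B $ k $ l = B $ l $ k" for k l
        using insert.prems(1) by (simp add: B_def mult.commute)
      moreover have "B $ k $ l = 0" if "k \<notin> S" for k l
      proof (cases "k = i")
        case True
        then show ?thesis using pos insert.prems(1)[of i l] by (simp add: B_def wk)
      next
        case False
        then have "A $ k $ l = 0" "w $ k = 0" using that insert.prems(3) by (simp_all add: wk)
        then show ?thesis by (simp add: B_def)
      qed
      ultimately have "(\<Sum>k\<in>UNIV. \<Sum>l\<in>UNIV. B $ k $ l * H $ k $ l) \<ge> 0"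
        by (intro insert.IH)
      moreover have "(\<Sum>k\<in>UNIV. \<Sum>l\<in>UNIV. A $ k $ l * H $ k $ l)
          = (\<Sum>k\<in>UNIV. \<Sum>l\<in>UNIV. B $ k $ l * H $ k $ l) + w \<bullet> (H *v w) / A $ i $ i"
        by (simp add: B_def matrix_vector_mult_def inner_vec_def sum_subtractf
          left_diff_distrib right_diff_distrib sum_divide_distrib sum_distrib_left mult_ac)
      ultimately show ?thesis using assms(3)[of w] pos by simp
    qed
  qed
  have "A $ i $ j = A $ j $ i" for i j
    using assms(1) by (metis transpose_def vec_lambda_beta)
  then show ?thesis using assms(2) by (intro main[of UNIV]) simp_all
qed

section \<open>Restrictions to lines\<close>

lemma has_derivative_grad:
  fixes f :: "real^'n::finite \<Rightarrow> real"
  assumes "f differentiable at x"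
  shows "(f has_derivative (\<lambda>w. grad f x \<bullet> w)) (at x)"
proof -
  let ?D = "frechet_derivative f (at x)"
  have lin: "linear ?D" using assms by (rule linear_frechet_derivative)
  have "?D w = grad f x \<bullet> w" for w
  proof -
    have "?D w = ?D (\<Sum>i\<in>UNIV. w $ i *\<^sub>R axis i 1)"
      by (simp only: scalar_mult_eq_scaleR[symmetric] basis_expansion)
    also have "\<dots> = (\<Sum>i\<in>UNIV. w $ i * ?D (axis i 1))"
      using lin by (simp add: linear_sum linear_cmul)
    finally show ?thesis
      by (simp add: inner_vec_def grad_def partial_derivative_def mult.commute)
  qed
  then have "?D = (\<lambda>w. grad f x \<bullet> w)" by auto
  then show ?thesis using assms unfolding frechet_derivative_works by simp
qed

lemma has_field_derivative_along_line:
  fixes f :: "real^'n::finite \<Rightarrow> real"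
  assumes "f differentiable at (x + t *\<^sub>R w)"
  shows "((\<lambda>t. f (x + t *\<^sub>R w)) has_field_derivative grad f (x + t *\<^sub>R w) \<bullet> w) (at t)"
proof -
  have "((\<lambda>t. x + t *\<^sub>R w) has_derivative (\<lambda>h. h *\<^sub>R w)) (at t)"
    by (auto intro!: derivative_eq_intros)
  from has_derivative_compose[OF this has_derivative_grad[OF assms]]
  show ?thesis by (simp add: has_field_derivative_def mult_commute_abs)
qed

lemma has_field_derivative_grad_along_line:
  fixes f :: "real^'n::finite \<Rightarrow> real"
  assumes "C2_on S f" "x \<in> S"
  shows "((\<lambda>t. grad f (x + t *\<^sub>R w) \<bullet> w) has_field_derivative w \<bullet> (hessian f x *v w)) (at 0)"
proof -
  have "((\<lambda>t. partial_derivative j f (x + t *\<^sub>R w)) has_field_derivative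
      grad (partial_derivative j f) x \<bullet> w) (at 0)" for j
    using has_field_derivative_along_line[of "partial_derivative j f" x 0 w] assms
    by (simp add: C2_on_def)
  then have "((\<lambda>t. \<Sum>j\<in>UNIV. partial_derivative j f (x + t *\<^sub>R w) * w $ j) has_field_derivative
      (\<Sum>j\<in>UNIV. (grad (partial_derivative j f) x \<bullet> w) * w $ j)) (at 0)"
    by (intro DERIV_sum DERIV_cmult_right)
  moreover have "(\<Sum>j\<in>UNIV. (grad (partial_derivative j f) x \<bullet> w) * w $ j)
      = w \<bullet> (hessian f x *v w)"
  proof -
    have "w \<bullet> (hessian f x *v w)
        = (\<Sum>i\<in>UNIV. \<Sum>j\<in>UNIV. w $ i * (partial_derivative i (partial_derivative j f) x * w $ j))"
      by (simp add: inner_vec_def hessian_def matrix_vector_mult_def sum_distrib_left)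
    also have "\<dots> = (\<Sum>j\<in>UNIV. (grad (partial_derivative j f) x \<bullet> w) * w $ j)"
      by (subst sum.swap) (simp add: inner_vec_def grad_def sum_distrib_left mult_ac)
    finally show ?thesis by simp
  qed
  ultimately show ?thesis by (simp add: grad_def inner_vec_def)
qed

lemma second_derivative_le_0_at_max:
  fixes f f' :: "real \<Rightarrow> real"
  assumes "d > 0" and f: "\<And>t. \<bar>t\<bar> < d \<Longrightarrow> (f has_field_derivative f' t) (at t)"
    and f': "(f' has_field_derivative s) (at 0)" and max: "\<And>t. \<bar>t\<bar> < d \<Longrightarrow> f t \<le> f 0"
  shows "s \<le> 0"
proof (rule ccontr)
  assume "\<not> s \<le> 0"
  then obtain e where e: "e > 0" "\<And>h. 0 < h \<Longrightarrow> h < e \<Longrightarrow> f' 0 < f' (0 + h)"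
    using DERIV_pos_inc_right[OF f'] by auto
  have "f' 0 = 0"
    using f[of 0] \<open>d > 0\<close> max by (intro DERIV_local_max[of f "f' 0" 0 d]) auto
  define t where "t = min d e / 2"
  have t: "0 < t" "t < d" "t < e" using \<open>d > 0\<close> \<open>e > 0\<close> by (auto simp: t_def)
  have "f 0 < f t"
  proof (rule DERIV_pos_imp_increasing_open[OF t(1)])
    show "\<exists>y. (f has_field_derivative y) (at r) \<and> y > 0" if "0 < r" "r < t" for r
      using f[of r] e(2)[of r] that t \<open>f' 0 = 0\<close> by auto
    show "continuous_on {0..t} f"
      using f t by (intro DERIV_continuous_on[of _ _ f']) (force intro: has_field_derivative_at_within)
  qed
  then show False using max[of t] t by simp
qed

section \<open>The maximum of the convexity function\<close>

lemma line_in_open: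
  fixes x :: "'a::real_normed_vector"
  assumes "open S" "x \<in> S"
  obtains d :: real where "d > 0" "\<And>t. \<bar>t\<bar> < d \<Longrightarrow> x + t *\<^sub>R w \<in> S"
proof -
  have "open ((\<lambda>t::real. x + t *\<^sub>R w) -` S)"
    using \<open>open S\<close> by (intro open_vimage) (auto intro!: continuous_intros)
  then obtain d where "d > 0" "ball 0 d \<subseteq> (\<lambda>t. x + t *\<^sub>R w) -` S"
    using \<open>x \<in> S\<close> by (metis (no_types, lifting) add.right_neutral open_contains_ball scale_zero_left vimage_eq)
  then show ?thesis by (intro that[of d]) (auto simp: subset_iff)
qed

text \<open>Displacing the end points with velocities \<open>p\<close> and \<open>q\<close> moves the intermediate point with
  velocity \<open>\<lambda> p + (1 - \<lambda>) q\<close>. The choices \<open>q = 0\<close> and \<open>p = 0\<close> match the gradients,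
  and \<open>p = q\<close> compares the Hessians.\<close>

lemma convexity_fun_max_conditions:
  fixes u :: "real^'n::finite \<Rightarrow> real"
  assumes "open S" "convex S" "C2_on S u" and x: "x1 \<in> S" "x3 \<in> S" and l: "0 < l" "l < 1"
    and max: "\<And>y1 y3. y1 \<in> S \<Longrightarrow> y3 \<in> S \<Longrightarrow> convexity_fun u y1 y3 l \<le> convexity_fun u x1 x3 l"
  defines "x2 \<equiv> l *\<^sub>R x1 + (1 - l) *\<^sub>R x3"
  shows "grad u x1 = grad u x2" "grad u x3 = grad u x2"
    and "w \<bullet> ((l *\<^sub>R hessian u x1 + (1 - l) *\<^sub>R hessian u x3 - hessian u x2) *v w) \<ge> 0"
proof -
  have mid: "l *\<^sub>R y1 + (1 - l) *\<^sub>R y3 \<in> S" if "y1 \<in> S" "y3 \<in> S" for y1 y3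
    using that \<open>convex S\<close> l by (intro convexD) auto
  have diff: "u differentiable at x" if "x \<in> S" for x
    using that \<open>C2_on S u\<close> by (simp add: C2_on_def)
  define f where "f p q t = u (x2 + t *\<^sub>R (l *\<^sub>R p + (1 - l) *\<^sub>R q))
      - l * u (x1 + t *\<^sub>R p) - (1 - l) * u (x3 + t *\<^sub>R q)" for p q t
  define f' where "f' p q t = grad u (x2 + t *\<^sub>R (l *\<^sub>R p + (1 - l) *\<^sub>R q)) \<bullet> (l *\<^sub>R p + (1 - l) *\<^sub>R q)
      - l * (grad u (x1 + t *\<^sub>R p) \<bullet> p) - (1 - l) * (grad u (x3 + t *\<^sub>R q) \<bullet> q)" for p q t
  have f_eq: "f p q t = convexity_fun u (x1 + t *\<^sub>R p) (x3 + t *\<^sub>R q) l" for p q t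
    by (simp add: f_def convexity_fun_def x2_def algebra_simps)
  have near: "\<exists>d>0. \<forall>t. \<bar>t\<bar> < d \<longrightarrow> f p q t \<le> f p q 0 \<and> (f p q has_field_derivative f' p q t) (at t)"
    for p q
  proof -
    obtain d1 where d1: "d1 > 0" "\<And>t. \<bar>t\<bar> < d1 \<Longrightarrow> x1 + t *\<^sub>R p \<in> S"
      using line_in_open[OF \<open>open S\<close> x(1)] by blast
    obtain d3 where d3: "d3 > 0" "\<And>t. \<bar>t\<bar> < d3 \<Longrightarrow> x3 + t *\<^sub>R q \<in> S"
      using line_in_open[OF \<open>open S\<close> x(2)] by blast
    have "f p q t \<le> f p q 0 \<and> (f p q has_field_derivative f' p q t) (at t)"
      if "\<bar>t\<bar> < min d1 d3" for t
    proof
      have S1: "x1 + t *\<^sub>R p \<in> S" and S3: "x3 + t *\<^sub>R q \<in> S" using that d1 d3 by auto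
      then show "f p q t \<le> f p q 0" unfolding f_eq using max by simp
      have "x2 + t *\<^sub>R (l *\<^sub>R p + (1 - l) *\<^sub>R q) = l *\<^sub>R (x1 + t *\<^sub>R p) + (1 - l) *\<^sub>R (x3 + t *\<^sub>R q)"
        by (simp add: x2_def algebra_simps)
      then have S2: "x2 + t *\<^sub>R (l *\<^sub>R p + (1 - l) *\<^sub>R q) \<in> S" using mid[OF S1 S3] by simp
      show "(f p q has_field_derivative f' p q t) (at t)"
        unfolding f_def f'_def
        by (intro DERIV_diff DERIV_cmult has_field_derivative_along_line diff S1 S2 S3)
    qed
    then show ?thesis using d1(1) d3(1) by (intro exI[of _ "min d1 d3"]) auto
  qed
  have f'0: "f' p q 0 = 0" for p q
  proof -
    obtain d where "d > 0" "\<And>t. \<bar>t\<bar> < d \<Longrightarrow> f p q t \<le> f p q 0"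
        "(f p q has_field_derivative f' p q 0) (at 0)"
      using near[of p q] by force
    then show ?thesis by (intro DERIV_local_max[of "f p q" "f' p q 0" 0 d]) auto
  qed
  have "l * ((grad u x2 - grad u x1) \<bullet> p) = 0" for p
    using f'0[of p 0] by (simp add: f'_def inner_simps algebra_simps)
  from this[of "grad u x2 - grad u x1"] show "grad u x1 = grad u x2" using l by simp
  have "(1 - l) * ((grad u x2 - grad u x3) \<bullet> q) = 0" for q
    using f'0[of 0 q] by (simp add: f'_def inner_simps algebra_simps)
  from this[of "grad u x2 - grad u x3"] show "grad u x3 = grad u x2" using l by simp
  have ww: "l *\<^sub>R w + (1 - l) *\<^sub>R w = w" by (simp add: algebra_simps)
  have "x2 \<in> S" unfolding x2_def using mid x by blast
  then have "(f' w w has_field_derivative w \<bullet> (hessian u x2 *v w)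
      - l * (w \<bullet> (hessian u x1 *v w)) - (1 - l) * (w \<bullet> (hessian u x3 *v w))) (at 0)"
    unfolding f'_def ww
    by (intro DERIV_diff DERIV_cmult has_field_derivative_grad_along_line[OF \<open>C2_on S u\<close>] x)
  moreover obtain d where "d > 0" "\<And>t. \<bar>t\<bar> < d \<Longrightarrow> f w w t \<le> f w w 0"
      "\<And>t. \<bar>t\<bar> < d \<Longrightarrow> (f w w has_field_derivative f' w w t) (at t)"
    using near[of w w] by blast
  ultimately have "w \<bullet> (hessian u x2 *v w)
      - l * (w \<bullet> (hessian u x1 *v w)) - (1 - l) * (w \<bullet> (hessian u x3 *v w)) \<le> 0"
    by (intro second_derivative_le_0_at_max[of d "f w w" "f' w w"])
  then show "w \<bullet> ((l *\<^sub>R hessian u x1 + (1 - l) *\<^sub>R hessian u x3 - hessian u x2) *v w) \<ge> 0"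
    by (simp add: matrix_vector_mult_diff_rdistrib matrix_vector_mult_add_rdistrib
      scaleR_matrix_vector_assoc[symmetric] inner_simps)
qed

text \<open>The essential supremum of a continuous function on an open set dominates every value:
  otherwise it would be exceeded on a nonempty open set, which is not negligible.\<close>

lemma le_Linfty_norm:
  fixes u :: "real^'n::finite \<Rightarrow> real"
  assumes "open S" "continuous_on S u" "x \<in> S"
  shows "ennreal \<bar>u x\<bar> \<le> Linfty_norm S u"
proof (rule ccontr)
  let ?m = "Linfty_norm S u"
  assume "\<not> ennreal \<bar>u x\<bar> \<le> ?m"
  define N where "N = S \<inter> (\<lambda>y. ennreal \<bar>u y\<bar>) -` {?m<..}"
  have "open N"
    unfolding N_def using assms
    by (intro continuous_open_preimage continuous_on_ennreal) (auto intro!: continuous_intros)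
  moreover have "x \<in> N" using \<open>\<not> _ \<le> ?m\<close> \<open>x \<in> S\<close> by (auto simp: N_def)
  ultimately have "\<not> negligible N" by (intro open_not_negligible) auto
  have S: "S \<in> sets lebesgue" using \<open>open S\<close> by simp
  have "AE y in lebesgue_on S. ennreal \<bar>u y\<bar> \<le> ?m"
    unfolding Linfty_norm_def by (rule esssup_AE)
  then have "AE y in lebesgue. y \<in> S \<longrightarrow> ennreal \<bar>u y\<bar> \<le> ?m"
    using S by (simp add: AE_restrict_space_iff)
  then have "AE y in lebesgue. y \<notin> N"
    by eventually_elim (auto simp: N_def)
  then have "negligible N"
    using \<open>open N\<close> by (simp add: negligible_iff_null_sets AE_iff_null_sets)
  then show False using \<open>\<not> negligible N\<close> by simp
qed

lemma Linfty_norm_le: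
  fixes f :: "real^'n::finite \<Rightarrow> real"
  assumes "open S" "continuous_on S f" and "\<And>x. x \<in> S \<Longrightarrow> \<bar>f x\<bar> \<le> c"
  shows "Linfty_norm S f \<le> ennreal c"
  unfolding Linfty_norm_def
proof (rule esssup_I)
  show "(\<lambda>x. ennreal \<bar>f x\<bar>) \<in> borel_measurable (lebesgue_on S)"
    using assms
    by (intro continuous_imp_measurable_on_sets_lebesgue continuous_on_ennreal)
      (auto intro!: continuous_intros)
  show "AE x in lebesgue_on S. ennreal \<bar>f x\<bar> \<le> ennreal c"
    using assms(3) by (intro AE_I2 ennreal_leI) simp
qed

lemma grad_in_ext_cball_C2_norm:
  assumes "x \<in> S"
  shows "grad u x \<in> ext_cball (C2_norm S u)"
proof -
  have "ennreal (norm (grad u x)) \<le> (SUP x\<in>S. ennreal (norm (grad u x)))"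
    using assms by (rule SUP_upper)
  also have "\<dots> \<le> C2_norm S u"
    unfolding C2_norm_def by (intro add_increasing2 add_increasing) auto
  finally show ?thesis by (simp add: ext_cball_def)
qed

lemma ext_cball_convex: "convex (ext_cball r :: 'a::real_normed_vector set)"
proof (cases r)
  case (real r)
  then have "ext_cball (ennreal r) = cball (0::'a) r" by (auto simp: ext_cball_def)
  then show ?thesis using real by simp
next
  case top
  then show ?thesis by (simp add: ext_cball_def)
qed

text \<open>The maximum principle. Only the value of \<open>b\<close> at the intermediate point is moved in
  its second argument, between two values bounded by the essential supremum of \<open>\<bar>u\<bar>\<close>, so the
  mean value theorem with the lower bound \<open>\<beta>\<close> on the derivative applies.\<close>

theorem positive_max_le:
  fixes S :: "(real^'n::finite) set"
  assumes "open S" "convex S"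
    and b_diff: "\<And>x s z. x \<in> S \<Longrightarrow> (\<lambda>t. b x t z) differentiable (at s)"
    and a: "\<And>\<xi>. transpose (a \<xi>) = a \<xi>" "\<And>\<xi>. positive_definite (a \<xi>)"
    and "C2_on S u"
    and pde: "\<And>x. x \<in> S \<Longrightarrow>
      (\<Sum>i\<in>UNIV. \<Sum>j\<in>UNIV. a (grad u x) $ i $ j * hessian u x $ i $ j) = b x (u x) (grad u x)"
    and "\<beta> > 0"
    and b_mono: "\<And>x s z. x \<in> S \<Longrightarrow> s \<in> ext_cball (Linfty_norm S u) \<Longrightarrow>
      z \<in> ext_cball (C2_norm S u) \<Longrightarrow> deriv (\<lambda>t. b x t z) s \<ge> \<beta>"
    and x: "x1 \<in> S" "x3 \<in> S" and "l \<in> {0..1}"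
    and joint: "\<And>z. z \<in> ext_cball (C2_norm S u) \<Longrightarrow> joint_convexity_fun_neg b u z x1 x3 l \<le> \<delta>"
    and max: "\<And>y1 y3. y1 \<in> S \<Longrightarrow> y3 \<in> S \<Longrightarrow> convexity_fun u y1 y3 l \<le> convexity_fun u x1 x3 l"
    and pos: "convexity_fun u x1 x3 l > 0"
  shows "convexity_fun u x1 x3 l \<le> \<delta> / \<beta>"
proof -
  define x2 where "x2 = l *\<^sub>R x1 + (1 - l) *\<^sub>R x3"
  define c where "c = l * u x1 + (1 - l) * u x3"
  define z where "z = grad u x2"
  define H where "H = l *\<^sub>R hessian u x1 + (1 - l) *\<^sub>R hessian u x3 - hessian u x2"
  have "x2 \<in> S"
    unfolding x2_def using \<open>convex S\<close> x \<open>l \<in> {0..1}\<close> by (intro convexD) auto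
  have gap: "convexity_fun u x1 x3 l = u x2 - c"
    by (simp add: convexity_fun_def x2_def c_def)
  have "l \<noteq> 0" "l \<noteq> 1" using pos by (auto simp: convexity_fun_def)
  then have l: "0 < l" "l < 1" using \<open>l \<in> {0..1}\<close> by auto
  note opt = convexity_fun_max_conditions[OF assms(1,2) \<open>C2_on S u\<close> x l max]
  have grads: "grad u x1 = z" "grad u x3 = z"
    using opt(1,2) by (simp_all add: z_def x2_def)
  have "0 \<le> (\<Sum>i\<in>UNIV. \<Sum>j\<in>UNIV. a z $ i $ j * H $ i $ j)"
  proof (rule psd_contraction_nonneg[OF a(1)])
    show "v \<bullet> (a z *v v) \<ge> 0" for v
      using a(2)[of z] by (cases "v = 0") (auto simp: positive_definite_def less_imp_le)
    show "v \<bullet> (H *v v) \<ge> 0" for v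
      unfolding H_def x2_def by (rule opt(3))
  qed
  also have "\<dots> = l * (\<Sum>i\<in>UNIV. \<Sum>j\<in>UNIV. a z $ i $ j * hessian u x1 $ i $ j)
      + (1 - l) * (\<Sum>i\<in>UNIV. \<Sum>j\<in>UNIV. a z $ i $ j * hessian u x3 $ i $ j)
      - (\<Sum>i\<in>UNIV. \<Sum>j\<in>UNIV. a z $ i $ j * hessian u x2 $ i $ j)"
    unfolding sum_distrib_left sum.distrib[symmetric] sum_subtractf[symmetric]
    by (intro sum.cong refl) (simp add: H_def algebra_simps)
  also have "\<dots> = l * b x1 (u x1) z + (1 - l) * b x3 (u x3) z - b x2 (u x2) z"
    using pde[OF x(1)] pde[OF x(2)] pde[OF \<open>x2 \<in> S\<close>] by (simp add: grads z_def[symmetric])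
  finally have elliptic: "b x2 (u x2) z \<le> l * b x1 (u x1) z + (1 - l) * b x3 (u x3) z" by simp
  have zM: "z \<in> ext_cball (C2_norm S u)"
    unfolding z_def using \<open>x2 \<in> S\<close> by (rule grad_in_ext_cball_C2_norm)
  have le_delta: "b x2 (u x2) z - b x2 c z \<le> \<delta>"
    using joint[OF zM] elliptic by (simp add: joint_convexity_fun_neg_def x2_def c_def)
  have "continuous_on S u"
    using \<open>C2_on S u\<close>
    by (auto simp: C2_on_def intro!: continuous_at_imp_continuous_on differentiable_imp_continuous_within)
  then have uM: "u x \<in> ext_cball (Linfty_norm S u)" if "x \<in> S" for x
    using le_Linfty_norm[OF \<open>open S\<close> _ that] by (simp add: ext_cball_def)
  have cM: "c \<in> ext_cball (Linfty_norm S u)"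
    using convexD[OF ext_cball_convex uM[OF x(1)] uM[OF x(2)], of l "1 - l"] l by (simp add: c_def)
  have "c < u x2" using pos gap by simp
  moreover have "((\<lambda>t. b x2 t z) has_field_derivative deriv (\<lambda>t. b x2 t z) s) (at s)" for s
    using b_diff[OF \<open>x2 \<in> S\<close>] by (simp add: DERIV_deriv_iff_real_differentiable)
  ultimately obtain s where s: "c < s" "s < u x2"
      "b x2 (u x2) z - b x2 c z = (u x2 - c) * deriv (\<lambda>t. b x2 t z) s"
    using MVT2[of c "u x2" "\<lambda>t. b x2 t z" "deriv (\<lambda>t. b x2 t z)"] by blast
  have "s \<in> ext_cball (Linfty_norm S u)"
    using ext_cball_convex[of "Linfty_norm S u"] cM uM[OF \<open>x2 \<in> S\<close>] s(1,2)
    by (meson is_interval_convex_1 mem_is_interval_1_I less_imp_le)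
  then have "deriv (\<lambda>t. b x2 t z) s \<ge> \<beta>" using b_mono \<open>x2 \<in> S\<close> zM by blast
  then have "(u x2 - c) * \<beta> \<le> \<delta>"
    using le_delta s \<open>c < u x2\<close> mult_left_mono[of \<beta> "deriv (\<lambda>t. b x2 t z) s" "u x2 - c"] by linarith
  then show ?thesis using \<open>\<beta> > 0\<close> by (simp add: gap field_simps)
qed

section \<open>Closeness to a convex function\<close>

theorem theorem2p5:
  shows "\<exists>k>0. \<forall>(\<Omega> :: (real^'n::finite) set) (a :: real^'n \<Rightarrow> real^'n^'n)
      (b :: real^'n \<Rightarrow> real \<Rightarrow> real^'n \<Rightarrow> real) (u :: real^'n \<Rightarrow> real) (\<delta>::real) (\<beta>::real).
    open \<Omega> \<and> connected \<Omega> \<and> convex \<Omega> \<and>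
    (\<forall>i j. (\<lambda>\<xi>. a \<xi> $ i $ j) \<in> borel_measurable lebesgue) \<and>
    (\<forall>x\<in>\<Omega>. \<forall>s z. (\<lambda>t. b x t z) differentiable (at s)) \<and>
    (\<forall>\<xi>. transpose (a \<xi>) = a \<xi> \<and> positive_definite (a \<xi>)) \<and>
    C2_on \<Omega> u \<and> continuous_on (closure \<Omega>) u \<and>
    (\<forall>x\<in>\<Omega>. (\<Sum>i\<in>UNIV. \<Sum>j\<in>UNIV. a (grad u x) $ i $ j * hessian u x $ i $ j)
              - b x (u x) (grad u x) = 0) \<and>
    \<delta> \<ge> 0 \<and> \<beta> > 0 \<and>
    (\<forall>x\<in>\<Omega>. \<forall>s\<in>ext_cball (Linfty_norm \<Omega> u). \<forall>z\<in>ext_cball (C2_norm \<Omega> u).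
       deriv (\<lambda>t. b x t z) s \<ge> \<beta>) \<and>
    (\<forall>x1\<in>\<Omega>. \<forall>x3\<in>\<Omega>. \<forall>l\<in>{0..1}. \<forall>z\<in>ext_cball (C2_norm \<Omega> u).
       joint_convexity_fun_neg b u z x1 x3 l \<le> \<delta>) \<and>
    positive_interior_max \<Omega> u
    \<longrightarrow> (\<exists>v :: real^'n \<Rightarrow> real. convex_on \<Omega> v \<and>
           Linfty_norm \<Omega> (\<lambda>x. u x - v x) \<le> ennreal (k / \<beta> * \<delta>))"
proof (intro exI[of _ "real (DIM(real^'n) + 2)"] conjI allI impI, goal_cases)
  case 1
  show ?case by simp
next
  case (2 \<Omega> a b u \<delta> \<beta>)
  then have "open \<Omega>" "convex \<Omega>" "\<delta> \<ge> 0" "\<beta> > 0" "C2_on \<Omega> u"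
    and b_diff: "\<And>x s z. x \<in> \<Omega> \<Longrightarrow> (\<lambda>t. b x t z) differentiable (at s)"
    and a: "\<And>\<xi>. transpose (a \<xi>) = a \<xi>" "\<And>\<xi>. positive_definite (a \<xi>)"
    and pde: "\<And>x. x \<in> \<Omega> \<Longrightarrow>
      (\<Sum>i\<in>UNIV. \<Sum>j\<in>UNIV. a (grad u x) $ i $ j * hessian u x $ i $ j) = b x (u x) (grad u x)"
    and b_mono: "\<And>x s z. x \<in> \<Omega> \<Longrightarrow> s \<in> ext_cball (Linfty_norm \<Omega> u) \<Longrightarrow>
      z \<in> ext_cball (C2_norm \<Omega> u) \<Longrightarrow> deriv (\<lambda>t. b x t z) s \<ge> \<beta>"
    and joint: "\<And>x1 x3 l z. x1 \<in> \<Omega> \<Longrightarrow> x3 \<in> \<Omega> \<Longrightarrow> l \<in> {0..1} \<Longrightarrow>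
      z \<in> ext_cball (C2_norm \<Omega> u) \<Longrightarrow> joint_convexity_fun_neg b u z x1 x3 l \<le> \<delta>"
    and cont: "continuous_on (closure \<Omega>) u" and "positive_interior_max \<Omega> u"
    by simp_all
  have cl: "x \<in> closure \<Omega>" if "x \<in> \<Omega>" for x
    using that closure_subset by (rule subsetD[rotated])
  obtain x1 x3 l where x: "x1 \<in> \<Omega>" "x3 \<in> \<Omega>" "l \<in> {0..1}" and pos: "convexity_fun u x1 x3 l > 0"
    and max: "\<And>y1 y3 t. y1 \<in> closure \<Omega> \<Longrightarrow> y3 \<in> closure \<Omega> \<Longrightarrow> t \<in> {0..1} \<Longrightarrow>
      convexity_fun u y1 y3 t \<le> convexity_fun u x1 x3 l"
    using \<open>positive_interior_max \<Omega> u\<close> unfolding positive_interior_max_def by metis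
  have bound: "convexity_fun u x1 x3 l \<le> \<delta> / \<beta>"
    by (rule positive_max_le[OF \<open>open \<Omega>\<close> \<open>convex \<Omega>\<close> b_diff a \<open>C2_on \<Omega> u\<close> pde \<open>\<beta> > 0\<close> b_mono x
          joint[OF x] max[OF cl cl x(3)] pos])
  have approx: "u (t *\<^sub>R x + (1 - t) *\<^sub>R y) \<le> t * u x + (1 - t) * u y + \<delta> / \<beta>"
    if "x \<in> \<Omega>" "y \<in> \<Omega>" "0 \<le> t" "t \<le> 1" for x y t
    using order_trans[OF max[OF cl cl] bound, of x y t] that by (simp add: convexity_fun_def)
  have "\<delta> / \<beta> \<ge> 0" using \<open>\<delta> \<ge> 0\<close> \<open>\<beta> > 0\<close> by simp
  obtain v where v: "convex_on \<Omega> v"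
      "\<And>x. x \<in> \<Omega> \<Longrightarrow> \<bar>u x - v x\<bar> \<le> (DIM(real^'n) + 2) * (\<delta> / \<beta>)"
    using approx_convex_imp_near_convex[OF \<open>convex \<Omega>\<close> \<open>\<delta> / \<beta> \<ge> 0\<close> approx] by blast
  have "Linfty_norm \<Omega> (\<lambda>x. u x - v x) \<le> ennreal (real (DIM(real^'n) + 2) / \<beta> * \<delta>)"
  proof (rule Linfty_norm_le[OF \<open>open \<Omega>\<close>])
    show "continuous_on \<Omega> (\<lambda>x. u x - v x)"
      using continuous_on_subset[OF cont closure_subset] convex_on_continuous[OF \<open>open \<Omega>\<close> v(1)]
      by (rule continuous_on_diff)
    show "\<bar>u x - v x\<bar> \<le> real (DIM(real^'n) + 2) / \<beta> * \<delta>" if "x \<in> \<Omega>" for x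
      using v(2)[OF that] by (simp only: times_divide_eq_right times_divide_eq_left)
  qed
  with v(1) show ?case by (intro exI[of _ v] conjI)
qed

end
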